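(* Let $(\mathcal{X},d_{\mathcal{X}})$ be a compact metric space, $(\mathcal{Y},d_{\mathcal{Y}})$ a metric space, $f\colon\mathcal{X}\to\mathcal{Y}$ a function, and $\rho\colon[0,\infty]\to[0,\infty]$ a monotonically increasing function. Assume that $\omega(f,\cdot)$ and $\rho(\cdot)^{-1}\omega(f,\cdot)$ are continuous as functions $[0,\infty]\to[0,\infty)$ and that $|f|_\rho<\infty$. Let $\{r_k\}_{k\in\mathbb{N}}$ be a non-increasing sequence with $\lim_{k\to\infty}r_k=0$, and let $X_{N_k}=\{x_1,\ldots,x_{N_k}\}\subset\mathcal{X}$ be $r_k/2$-nets for $\mathcal{X}$ with $X_{N_k}\subset X_{N_{k+1}}$ for all $k\in\mathbb{N}$. Let $f_{N_k}=f|_{X_{N_k}}$. Then $$\lim_{k\to\infty}|f_{N_k}|_{\rho,N_k}=\lim_{k\to\infty}|f|_{\rho,N_k}=|f|_\rho.$$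
   Context: An $\varepsilon$-net for $\mathcal{X}$ is a subset $\mathcal{K}\subset\mathcal{X}$ such that each $x\in\mathcal{X}$ satisfies $d_{\mathcal{X}}(x,x')\leq\varepsilon$ for some $x'\in\mathcal{K}$. The modulus of continuity is $\omega(f,t)=\sup\{d_{\mathcal{Y}}(f(x),f(x')): x,x'\in\mathcal{X},\ d_{\mathcal{X}}(x,x')\leq t\}$, $t\in[0,\infty]$, and $|f|_\rho=\sup_{t>0}\rho(t)^{-1}\omega(f,t)$. For a finite set $X_N=\{x_1,\ldots,x_N\}\subset\mathcal{X}$ of distinct data sites put $d_{i,j}=d_{\mathcal{X}}(x_i,x_j)$, $\omega_N(f,t)=\max\{d_{\mathcal{Y}}(f(x_i),f(x_j)): d_{i,j}\leq t\}$, and $|f|_{\rho,N}=\max_{i\neq j}\rho(d_{i,j})^{-1}\omega_N(f,d_{i,j})$. For the restriction $f_N=f|_{X_N}$, $|f_N|_{\rho,N}$ is defined by the same formula (it depends only on the values $f(x_i)$). If $\rho(0)=0$, continuity of $\rho(\cdot)^{-1}\omega(f,\cdot)$ at $t=0$ is understood in the sense that this function, defined for $t>0$, extends continuously to $t=0$ with a finite value. *)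

theory Defs
  imports "HOL-Analysis.Analysis"
begin

text \<open>
  A metric space \<open>\<X>\<close> is represented by a subset \<open>X\<close> of a type of class \<^class>\<open>metric_space\<close>
  with the induced metric; a map on \<open>\<X>\<close> is a total function whose values off \<open>X\<close> are never used.
  The interval \<open>[0,\<infinity>]\<close> is the type \<^typ>\<open>ennreal\<close>, so that \<open>inverse 0 = \<infinity>\<close>,
  \<open>inverse \<infinity> = 0\<close> and \<open>\<infinity> * 0 = 0\<close>.
\<close>

definition eps_net :: "'a::metric_space set \<Rightarrow> real \<Rightarrow> 'a set \<Rightarrow> bool" where
  "eps_net X \<epsilon> K \<longleftrightarrow> K \<subseteq> X \<and> (\<forall>x\<in>X. \<exists>x'\<in>K. dist x x' \<le> \<epsilon>)"

definition modulus :: "'a::metric_space set \<Rightarrow> ('a \<Rightarrow> 'b::metric_space) \<Rightarrow> ennreal \<Rightarrow> ennreal" where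
  "modulus X f t =
     Sup {ennreal (dist (f x) (f x')) | x x'. x \<in> X \<and> x' \<in> X \<and> ennreal (dist x x') \<le> t}"

definition quot_modulus ::
  "'a::metric_space set \<Rightarrow> (ennreal \<Rightarrow> ennreal) \<Rightarrow> ('a \<Rightarrow> 'b::metric_space) \<Rightarrow> ennreal \<Rightarrow> ennreal" where
  "quot_modulus X \<rho> f t = inverse (\<rho> t) * modulus X f t"

definition seminorm_rho ::
  "'a::metric_space set \<Rightarrow> (ennreal \<Rightarrow> ennreal) \<Rightarrow> ('a \<Rightarrow> 'b::metric_space) \<Rightarrow> ennreal" where
  "seminorm_rho X \<rho> f = (SUP t\<in>{0<..}. quot_modulus X \<rho> f t)"

text \<open>
  Continuity of \<open>\<rho>\<^sup>-\<^sup>1 \<omega>(f,\<cdot>)\<close> as a function \<open>[0,\<infinity>] \<rightarrow> [0,\<infinity>)\<close>. If \<open>\<rho> 0 = 0\<close>, the function is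
  only considered for \<open>t > 0\<close> and is required to extend continuously to \<open>t = 0\<close> with a finite
  value, which may differ from the value \<open>\<infinity> * 0 = 0\<close> that \<^typ>\<open>ennreal\<close> assigns there.
\<close>

definition quot_modulus_continuous ::
  "'a::metric_space set \<Rightarrow> (ennreal \<Rightarrow> ennreal) \<Rightarrow> ('a \<Rightarrow> 'b::metric_space) \<Rightarrow> bool" where
  "quot_modulus_continuous X \<rho> f \<longleftrightarrow>
     (\<exists>g. continuous_on UNIV g \<and> (\<forall>t. g t < \<infinity>) \<and>
          (\<forall>t>0. g t = quot_modulus X \<rho> f t) \<and>
          (\<rho> 0 \<noteq> 0 \<longrightarrow> g 0 = quot_modulus X \<rho> f 0))"

text \<open>
  The discrete notions take the finite set \<open>P = {x\<^sub>1, \<dots>, x\<^sub>N}\<close> of distinct sites, so that pairs of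
  indices \<open>i \<noteq> j\<close> become pairs of points \<open>x \<noteq> y\<close>. Inserting \<open>0\<close> gives the value \<open>0\<close> to the maximum
  over the empty set of pairs (\<open>N = 1\<close>).
\<close>

definition modulus_N :: "'a::metric_space set \<Rightarrow> ('a \<Rightarrow> 'b::metric_space) \<Rightarrow> ennreal \<Rightarrow> ennreal" where
  "modulus_N P f t =
     Max {ennreal (dist (f x) (f y)) | x y. x \<in> P \<and> y \<in> P \<and> ennreal (dist x y) \<le> t}"

definition seminorm_rho_N ::
  "'a::metric_space set \<Rightarrow> (ennreal \<Rightarrow> ennreal) \<Rightarrow> ('a \<Rightarrow> 'b::metric_space) \<Rightarrow> ennreal" where
  "seminorm_rho_N P \<rho> f =
     Max (insert 0 {inverse (\<rho> (ennreal (dist x y))) * modulus_N P f (ennreal (dist x y)) | x y.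
                      x \<in> P \<and> y \<in> P \<and> x \<noteq> y})"

end

theory Submission
  imports Defs
begin

text \<open>
  By compactness the supremum defining \<open>|f|\<^sub>\<rho>\<close> may be restricted to values \<open>t = d(x,x') > 0\<close>
  attained by the metric. Approximating \<open>x\<close> and \<open>x'\<close> by net points gives attained distances
  \<open>s\<^sub>k \<rightarrow> t\<close>, and moving an arbitrary pair to the net yields
  \<open>\<omega>(f, s\<^sub>k - r\<^sub>k) - 2 \<omega>(f, r\<^sub>k/2) \<le> \<omega>\<^sub>N(f, s\<^sub>k) \<le> \<omega>(f, s\<^sub>k)\<close>, so \<open>\<omega>\<^sub>N(f, s\<^sub>k) / \<omega>(f, s\<^sub>k) \<rightarrow> 1\<close>.
  Multiplying by \<open>\<rho>(s\<^sub>k)\<^sup>-\<^sup>1 \<omega>(f, s\<^sub>k) \<rightarrow> \<rho>(t)\<^sup>-\<^sup>1 \<omega>(f, t)\<close> needs no continuity of \<open>\<rho>\<close> itself.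
\<close>

section \<open>The modulus of continuity and its discrete version\<close>

lemma inverse_ennreal_antimono: "a \<le> b \<Longrightarrow> inverse b \<le> inverse (a :: ennreal)"
  by (simp add: less_eq_ennreal.rep_eq inverse_ennreal.rep_eq ereal_inverse_antimono)

lemma dist_le_modulus:
  assumes "x \<in> X" "y \<in> X" "ennreal (dist x y) \<le> t"
  shows "ennreal (dist (f x) (f y)) \<le> modulus X f t"
  unfolding modulus_def using assms by (intro Sup_upper) blast

lemma modulus_leI:
  assumes "\<And>x y. x \<in> X \<Longrightarrow> y \<in> X \<Longrightarrow> ennreal (dist x y) \<le> t \<Longrightarrow> ennreal (dist (f x) (f y)) \<le> c"
  shows "modulus X f t \<le> c"
  unfolding modulus_def using assms by (intro Sup_least) blast

lemma modulus_zero: "modulus X f 0 = 0"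
  by (rule antisym[OF modulus_leI]) auto

lemma finite_modulus_N_set:
  assumes "finite P"
  shows "finite {ennreal (dist (f x) (f y)) | x y. x \<in> P \<and> y \<in> P \<and> ennreal (dist x y) \<le> t}"
  by (rule finite_subset[of _ "(\<lambda>(x, y). ennreal (dist (f x) (f y))) ` (P \<times> P)"]) (use assms in auto)

lemma dist_le_modulus_N:
  assumes "finite P" "x \<in> P" "y \<in> P" "ennreal (dist x y) \<le> t"
  shows "ennreal (dist (f x) (f y)) \<le> modulus_N P f t"
  unfolding modulus_N_def using assms by (intro Max_ge finite_modulus_N_set) blast+

text \<open>A finite nonempty set has the same \<open>Max\<close> and \<open>Sup\<close>. A point of
  \<open>P\<close> paired with itself shows that the set of values is nonempty for every
  \<open>t\<close>; on the empty set \<open>Max\<close> would be unspecified.\<close>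

lemma modulus_N_eq_modulus:
  assumes "finite P" "P \<noteq> {}"
  shows "modulus_N P f t = modulus P f t"
proof -
  obtain p where "p \<in> P" using assms by blast
  then have "ennreal (dist (f p) (f p)) \<in>
      {ennreal (dist (f x) (f y)) | x y. x \<in> P \<and> y \<in> P \<and> ennreal (dist x y) \<le> t}"
    by (intro CollectI exI[of _ p]) auto
  then show ?thesis
    unfolding modulus_def modulus_N_def
    using assms by (intro Max_Sup finite_modulus_N_set) blast+
qed

lemma modulus_mono_set: "P \<subseteq> X \<Longrightarrow> modulus P f t \<le> modulus X f t"
  by (auto intro!: modulus_leI dist_le_modulus)

lemma modulus_N_restrict: "modulus_N P (restrict f P) t = modulus_N P f t"
  unfolding modulus_N_def by (rule arg_cong[where f = Max]) force

lemma seminorm_rho_N_restrict: "seminorm_rho_N P \<rho> (restrict f P) = seminorm_rho_N P \<rho> f"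
  unfolding seminorm_rho_N_def modulus_N_restrict ..

section \<open>The discrete seminorm\<close>

lemma finite_seminorm_rho_N_set:
  assumes "finite P"
  shows "finite (insert 0 {inverse (\<rho> (ennreal (dist x y))) * modulus_N P f (ennreal (dist x y)) | x y.
                   x \<in> P \<and> y \<in> P \<and> x \<noteq> y})"
  unfolding finite_insert
  by (rule finite_subset[of _
        "(\<lambda>(x, y). inverse (\<rho> (ennreal (dist x y))) * modulus_N P f (ennreal (dist x y))) ` (P \<times> P)"])
    (use assms in auto)

lemma le_seminorm_rho_N:
  assumes "finite P" "x \<in> P" "y \<in> P" "x \<noteq> y"
  shows "inverse (\<rho> (ennreal (dist x y))) * modulus_N P f (ennreal (dist x y)) \<le> seminorm_rho_N P \<rho> f"
  unfolding seminorm_rho_N_def using assms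
  by (intro Max_ge finite_seminorm_rho_N_set) blast+

lemma seminorm_rho_N_le:
  assumes "finite P" "P \<subseteq> X"
  shows "seminorm_rho_N P \<rho> f \<le> seminorm_rho X \<rho> f"
proof -
  have "inverse (\<rho> (ennreal (dist x y))) * modulus_N P f (ennreal (dist x y)) \<le> seminorm_rho X \<rho> f"
    if "x \<in> P" "y \<in> P" "x \<noteq> y" for x y
  proof -
    have "modulus_N P f (ennreal (dist x y)) \<le> modulus X f (ennreal (dist x y))"
      using that assms by (subst modulus_N_eq_modulus) (auto intro: modulus_mono_set)
    then have "inverse (\<rho> (ennreal (dist x y))) * modulus_N P f (ennreal (dist x y))
        \<le> quot_modulus X \<rho> f (ennreal (dist x y))"
      unfolding quot_modulus_def by (rule mult_left_mono) simp
    also have "\<dots> \<le> seminorm_rho X \<rho> f"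
      unfolding seminorm_rho_def using that by (intro SUP_upper) auto
    finally show ?thesis .
  qed
  then show ?thesis
    unfolding seminorm_rho_N_def
    by (intro Max.boundedI finite_seminorm_rho_N_set assms) auto
qed

section \<open>Attained distances and approximation by nets\<close>

lemma modulus_le_attained_distance:
  assumes "compact X" "modulus X f t > 0"
  obtains x y where "x \<in> X" "y \<in> X" "x \<noteq> y" "ennreal (dist x y) \<le> t"
    "modulus X f t \<le> modulus X f (ennreal (dist x y))"
proof -
  define C where "C = (X \<times> X) \<inter> {p. ennreal (dist (fst p) (snd p)) \<le> t}"
  have "closed {p :: 'a \<times> 'a. ennreal (dist (fst p) (snd p)) \<le> t}"
    by (intro closed_Collect_le continuous_on_ennreal continuous_intros)
  then have C: "compact C"
    unfolding C_def using assms(1) by (intro compact_Int_closed compact_Times)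
  have "C \<noteq> {}"
  proof
    assume "C = {}"
    then have "modulus X f t \<le> 0"
      by (intro modulus_leI) (auto simp: C_def)
    then show False using assms(2) by simp
  qed
  then obtain p where p: "p \<in> C" "\<And>q. q \<in> C \<Longrightarrow> dist (fst q) (snd q) \<le> dist (fst p) (snd p)"
    using continuous_attains_sup[OF C, of "\<lambda>p. dist (fst p) (snd p)"]
      continuous_on_dist[OF continuous_on_fst continuous_on_snd, OF continuous_on_id continuous_on_id]
    by blast
  obtain x y where xy: "p = (x, y)" by fastforce
  have mem: "x \<in> X" "y \<in> X" "ennreal (dist x y) \<le> t"
    using p(1) by (auto simp: C_def xy)
  have max: "dist x' y' \<le> dist x y"
    if "x' \<in> X" "y' \<in> X" "ennreal (dist x' y') \<le> t" for x' y'
    using p(2)[of "(x', y')"] that by (simp add: C_def xy)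
  then have le: "modulus X f t \<le> modulus X f (ennreal (dist x y))"
    by (intro modulus_leI dist_le_modulus ennreal_leI) auto
  \<comment> \<open>If \<open>x = y\<close>, the bound would be the modulus at 0, which
    vanishes.\<close>
  moreover have "x \<noteq> y"
    using le assms(2) by (auto simp: modulus_zero)
  ultimately show ?thesis using that mem by blast
qed

text \<open>Moving both points of a pair to the net lengthens their distance by at most
  \<open>2 * \<epsilon>\<close>, and each move changes the value of \<open>f\<close> by at most the
  modulus at \<open>\<epsilon>\<close>.\<close>

lemma modulus_le_modulus_N_net:
  assumes "finite P" "eps_net X \<epsilon> P" and pos: "s - 2 * \<epsilon> \<ge> 0"
  shows "modulus X f (ennreal (s - 2 * \<epsilon>)) \<le> modulus_N P f (ennreal s) + 2 * modulus X f (ennreal \<epsilon>)"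
proof (rule modulus_leI)
  fix x y assume xy: "x \<in> X" "y \<in> X" "ennreal (dist x y) \<le> ennreal (s - 2 * \<epsilon>)"
  obtain x' y' where x': "x' \<in> P" "dist x x' \<le> \<epsilon>" and y': "y' \<in> P" "dist y y' \<le> \<epsilon>"
    using assms(2) xy unfolding eps_net_def by meson
  have sub: "x' \<in> X" "y' \<in> X" using assms(2) x' y' by (auto simp: eps_net_def)
  \<comment> \<open>Since \<open>ennreal\<close> sends negative reals to 0, \<open>pos\<close> is
    what allows the bound to be read in the reals.\<close>
  have "dist x y \<le> s - 2 * \<epsilon>" using xy(3) pos by simp
  then have "dist x' y' \<le> s"
    using x'(2) y'(2) dist_triangle[of x' y' x] dist_triangle[of x y' y]
    by (simp add: dist_commute)
  then have fN: "ennreal (dist (f x') (f y')) \<le> modulus_N P f (ennreal s)"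
    using assms(1) x' y' by (intro dist_le_modulus_N ennreal_leI) auto
  have fx: "ennreal (dist (f x) (f x')) \<le> modulus X f (ennreal \<epsilon>)"
    using xy sub x' by (intro dist_le_modulus ennreal_leI) auto
  have fy: "ennreal (dist (f y) (f y')) \<le> modulus X f (ennreal \<epsilon>)"
    using xy sub y' by (intro dist_le_modulus ennreal_leI) auto
  have "dist (f x) (f y) \<le> dist (f x') (f y') + (dist (f x) (f x') + dist (f y) (f y'))"
    using dist_triangle[of "f x" "f y" "f x'"] dist_triangle[of "f x'" "f y" "f y'"]
    by (simp add: dist_commute)
  then have "ennreal (dist (f x) (f y)) \<le>
      ennreal (dist (f x') (f y')) + (ennreal (dist (f x) (f x')) + ennreal (dist (f y) (f y')))"
    by (simp flip: ennreal_plus add: ennreal_leI)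
  also have "\<dots> \<le> modulus_N P f (ennreal s) + (modulus X f (ennreal \<epsilon>) + modulus X f (ennreal \<epsilon>))"
    by (intro add_mono fN fx fy)
  finally show "ennreal (dist (f x) (f y)) \<le> modulus_N P f (ennreal s) + 2 * modulus X f (ennreal \<epsilon>)"
    by (simp add: mult_2)
qed

lemma tendsto_modulus_N:
  fixes s r :: "nat \<Rightarrow> real" and t :: real
  assumes cont: "continuous_on UNIV (modulus X f)" and fin: "\<forall>t. modulus X f t < \<infinity>"
    and r: "r \<longlonglongrightarrow> 0" and P: "\<And>k. finite (XN k)" "\<And>k. eps_net X (r k / 2) (XN k)"
    and ne: "X \<noteq> {}" and s: "s \<longlonglongrightarrow> t" "t > 0"
  shows "(\<lambda>k. modulus_N (XN k) f (ennreal (s k))) \<longlonglongrightarrow> modulus X f (ennreal t)"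
proof -
  have lim: "(\<lambda>k. modulus X f (u k)) \<longlonglongrightarrow> modulus X f l" if "u \<longlonglongrightarrow> l" for u l
    using continuous_on_tendsto_compose[OF cont that] by simp
  have r2: "(\<lambda>k. r k / 2) \<longlonglongrightarrow> 0" using tendsto_divide[OF r tendsto_const[of 2]] by simp
  \<comment> \<open>This is the net estimate with \<open>\<epsilon> = r k / 2\<close>, solved for
    the discrete modulus. The subtracted term tends to 0 because the modulus is continuous and
    vanishes at 0.\<close>
  have lower: "(\<lambda>k. modulus X f (ennreal (s k - 2 * (r k / 2))) - 2 * modulus X f (ennreal (r k / 2)))
      \<longlonglongrightarrow> modulus X f (ennreal t)"
  proof -
    have "(\<lambda>k. s k - 2 * (r k / 2)) \<longlonglongrightarrow> t"
      using tendsto_diff[OF s(1) r] by simp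
    then have 1: "(\<lambda>k. modulus X f (ennreal (s k - 2 * (r k / 2)))) \<longlonglongrightarrow> modulus X f (ennreal t)"
      by (intro lim tendsto_ennrealI)
    have "(\<lambda>k. modulus X f (ennreal (r k / 2))) \<longlonglongrightarrow> modulus X f (ennreal 0)"
      by (intro lim tendsto_ennrealI r2)
    then have "(\<lambda>k. 2 * modulus X f (ennreal (r k / 2))) \<longlonglongrightarrow> 2 * 0"
      by (intro ennreal_tendsto_cmult) (auto simp: modulus_zero)
    from tendsto_diff_ennreal[OF 1 this] fin show ?thesis
      by (simp add: less_top[symmetric])
  qed
  have upper: "(\<lambda>k. modulus X f (ennreal (s k))) \<longlonglongrightarrow> modulus X f (ennreal t)"
    by (intro lim tendsto_ennrealI s)
  \<comment> \<open>As \<open>t > 0\<close>, the net estimate is applicable for all large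
    \<open>k\<close>.\<close>
  have "(\<lambda>k. s k - r k) \<longlonglongrightarrow> t" using tendsto_diff[OF s(1) r] by simp
  then have "eventually (\<lambda>k. s k - r k > 0) sequentially"
    using s(2) by (rule order_tendstoD)
  then have ev: "eventually (\<lambda>k. modulus X f (ennreal (s k - 2 * (r k / 2))) - 2 * modulus X f (ennreal (r k / 2))
      \<le> modulus_N (XN k) f (ennreal (s k))) sequentially"
  proof eventually_elim
    case (elim k)
    then show ?case
      using modulus_le_modulus_N_net[OF P(1)[of k] P(2)[of k], of "s k" f] fin
      by (simp add: ennreal_minus_le_iff add.commute less_top[symmetric])
  qed
  have "modulus_N (XN k) f (ennreal (s k)) \<le> modulus X f (ennreal (s k))" for k
    using P[of k] ne by (subst modulus_N_eq_modulus) (auto simp: eps_net_def intro!: modulus_mono_set)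
  then show ?thesis
    by (intro tendsto_sandwich[OF ev _ lower upper]) simp
qed

text \<open>The continuous extension agrees with the quotient at positive arguments, and
  \<open>s k\<close> is eventually positive; so the value at 0 does not matter.\<close>

lemma tendsto_quot_modulus:
  assumes "quot_modulus_continuous X \<rho> f" "s \<longlonglongrightarrow> t" "t > 0"
  shows "(\<lambda>k. quot_modulus X \<rho> f (s k)) \<longlonglongrightarrow> quot_modulus X \<rho> f t"
proof -
  obtain g where g: "continuous_on UNIV g" "\<And>t. t > 0 \<Longrightarrow> g t = quot_modulus X \<rho> f t"
    using assms(1) unfolding quot_modulus_continuous_def by blast
  have "(\<lambda>k. g (s k)) \<longlonglongrightarrow> g t"
    using continuous_on_tendsto_compose[OF g(1) assms(2)] by simp
  moreover have "eventually (\<lambda>k. g (s k) = quot_modulus X \<rho> f (s k)) sequentially"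
    using order_tendstoD(1)[OF assms(2,3)] by eventually_elim (rule g(2))
  ultimately show ?thesis using g(2)[OF assms(3)] tendsto_cong by force
qed

lemma eps_nets_tendsto_point:
  assumes "\<And>k. eps_net X (\<epsilon> k) (P k)" "\<epsilon> \<longlonglongrightarrow> 0" "x \<in> X"
  obtains p where "\<And>k. p k \<in> P k" "p \<longlonglongrightarrow> x"
proof -
  have "\<forall>k. \<exists>p\<in>P k. dist x p \<le> \<epsilon> k"
    using assms(1,3) by (auto simp: eps_net_def)
  then obtain p where p: "\<And>k. p k \<in> P k" "\<And>k. dist x (p k) \<le> \<epsilon> k" by metis
  have "(\<lambda>k. dist (p k) x) \<longlonglongrightarrow> 0"
    using p(2) by (intro tendsto_sandwich[OF _ _ tendsto_const assms(2)])
      (auto simp: dist_commute)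
  then have "p \<longlonglongrightarrow> x" by (rule tendsto_dist_iff[THEN iffD2])
  then show ?thesis using that p(1) by blast
qed

lemma tendsto_seminorm_rho_N:
  fixes X :: "'a::metric_space set" and f :: "'a \<Rightarrow> 'b::metric_space"
  assumes X: "compact X" and mono: "mono \<rho>"
    and cont: "continuous_on UNIV (modulus X f)" and fin: "\<forall>t. modulus X f t < \<infinity>"
    and quot: "quot_modulus_continuous X \<rho> f" and bdd: "seminorm_rho X \<rho> f < \<infinity>"
    and r: "r \<longlonglongrightarrow> 0" and P: "\<And>k. finite (XN k)" "\<And>k. eps_net X (r k / 2) (XN k)"
  shows "(\<lambda>k. seminorm_rho_N (XN k) \<rho> f) \<longlonglongrightarrow> seminorm_rho X \<rho> f"
proof (rule order_tendstoI)
  fix a assume "seminorm_rho X \<rho> f < a"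
  moreover have "seminorm_rho_N (XN k) \<rho> f \<le> seminorm_rho X \<rho> f" for k
    using P[of k] by (intro seminorm_rho_N_le) (auto simp: eps_net_def)
  ultimately show "eventually (\<lambda>k. seminorm_rho_N (XN k) \<rho> f < a) sequentially"
    by (intro always_eventually) (auto intro: le_less_trans)
next
  fix a assume "a < seminorm_rho X \<rho> f"
  then obtain t where t: "t > 0" "a < quot_modulus X \<rho> f t"
    unfolding seminorm_rho_def by (auto simp: less_SUP_iff)
  \<comment> \<open>With \<open>\<infinity> * 0 = 0\<close> in \<open>ennreal\<close>, a vanishing
    modulus would make the quotient 0 even if \<open>\<rho> t = 0\<close>.\<close>
  have "modulus X f t > 0"
    using t(2) by (auto simp: quot_modulus_def zero_less_iff_neq_zero)
  then obtain x y where xy: "x \<in> X" "y \<in> X" "x \<noteq> y" "ennreal (dist x y) \<le> t"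
    "modulus X f t \<le> modulus X f (ennreal (dist x y))"
    using modulus_le_attained_distance[OF X] by blast
  define d where "d = dist x y"
  have d: "d > 0" using xy by (simp add: d_def)
  \<comment> \<open>Passing from \<open>t\<close> to the attained distance \<open>d \<le> t\<close>
    keeps the modulus and can only increase the inverse of the monotone \<open>\<rho>\<close>, so
    the quotient stays above \<open>a\<close>.\<close>
  have "inverse (\<rho> t) \<le> inverse (\<rho> (ennreal d))"
    using monoD[OF mono xy(4)] by (simp add: d_def inverse_ennreal_antimono)
  then have "quot_modulus X \<rho> f t \<le> quot_modulus X \<rho> f (ennreal d)"
    unfolding quot_modulus_def using xy(5) by (intro mult_mono) (auto simp: d_def)
  then have ad: "a < quot_modulus X \<rho> f (ennreal d)" using t(2) by simp
  have \<omega>d: "modulus X f (ennreal d) \<noteq> 0"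
    using ad by (auto simp: quot_modulus_def)
  have r2: "(\<lambda>k. r k / 2) \<longlonglongrightarrow> 0" using tendsto_divide[OF r tendsto_const[of 2]] by simp
  obtain p where p: "\<And>k. p k \<in> XN k" "p \<longlonglongrightarrow> x"
    using eps_nets_tendsto_point[OF P(2) r2 xy(1)] by blast
  obtain q where q: "\<And>k. q k \<in> XN k" "q \<longlonglongrightarrow> y"
    using eps_nets_tendsto_point[OF P(2) r2 xy(2)] by blast
  define s where "s k = dist (p k) (q k)" for k
  have s: "s \<longlonglongrightarrow> d" unfolding s_def d_def by (intro tendsto_dist p q)
  have quot_lim: "(\<lambda>k. quot_modulus X \<rho> f (ennreal (s k))) \<longlonglongrightarrow> quot_modulus X \<rho> f (ennreal d)"
    using d by (intro tendsto_quot_modulus[OF quot] tendsto_ennrealI s) simp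
  have \<omega>_lim: "(\<lambda>k. modulus X f (ennreal (s k))) \<longlonglongrightarrow> modulus X f (ennreal d)"
    using continuous_on_tendsto_compose[OF cont tendsto_ennrealI[OF s]] by simp
  have \<omega>N_lim: "(\<lambda>k. modulus_N (XN k) f (ennreal (s k))) \<longlonglongrightarrow> modulus X f (ennreal d)"
    by (rule tendsto_modulus_N[OF cont fin r P _ s d]) (use xy in auto)
  \<comment> \<open>The limit \<open>modulus X f d\<close> is neither 0 nor infinite. Hence the
    product of limits is not of the form \<open>0 * \<infinity>\<close>, and the ratio tends to
    1.\<close>
  have "(\<lambda>k. inverse (modulus X f (ennreal (s k)))) \<longlonglongrightarrow> inverse (modulus X f (ennreal d))"
    using continuous_on_tendsto_compose[OF continuous_on_inverse_ennreal[OF continuous_on_id] \<omega>_lim, of UNIV]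
    by simp
  then have "(\<lambda>k. modulus_N (XN k) f (ennreal (s k)) / modulus X f (ennreal (s k)))
      \<longlonglongrightarrow> modulus X f (ennreal d) / modulus X f (ennreal d)"
    unfolding divide_ennreal_def
    using \<omega>d fin by (intro tendsto_mult_ennreal \<omega>N_lim) (auto simp: less_top[symmetric])
  then have ratio: "(\<lambda>k. modulus_N (XN k) f (ennreal (s k)) / modulus X f (ennreal (s k))) \<longlonglongrightarrow> 1"
    using \<omega>d fin by (simp add: less_top[symmetric])
  have qd_fin: "quot_modulus X \<rho> f (ennreal d) < \<infinity>"
    using d by (intro le_less_trans[OF _ bdd]) (auto simp: seminorm_rho_def intro!: SUP_upper)
  have "(\<lambda>k. quot_modulus X \<rho> f (ennreal (s k)) *
        (modulus_N (XN k) f (ennreal (s k)) / modulus X f (ennreal (s k))))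
      \<longlonglongrightarrow> quot_modulus X \<rho> f (ennreal d) * 1"
    using qd_fin by (intro tendsto_mult_ennreal quot_lim ratio) (auto simp: less_top[symmetric])
  then have "eventually (\<lambda>k. a < quot_modulus X \<rho> f (ennreal (s k)) *
        (modulus_N (XN k) f (ennreal (s k)) / modulus X f (ennreal (s k)))) sequentially"
    using ad by (intro order_tendstoD) auto
  moreover have "eventually (\<lambda>k. 0 < modulus X f (ennreal (s k))) sequentially"
    using \<omega>d by (intro order_tendstoD[OF \<omega>_lim]) (simp add: zero_less_iff_neq_zero)
  moreover have "eventually (\<lambda>k. 0 < s k) sequentially"
    using s d by (rule order_tendstoD)
  ultimately show "eventually (\<lambda>k. a < seminorm_rho_N (XN k) \<rho> f) sequentially"
  proof eventually_elim
    case (elim k)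
    let ?\<omega> = "modulus X f (ennreal (s k))" and ?\<omega>N = "modulus_N (XN k) f (ennreal (s k))"
    \<comment> \<open>The modulus at \<open>s k\<close> is positive and finite, so it cancels and
      leaves a term of the discrete seminorm.\<close>
    have "quot_modulus X \<rho> f (ennreal (s k)) * (?\<omega>N / ?\<omega>)
        = inverse (\<rho> (ennreal (s k))) * ?\<omega>N * (?\<omega> / ?\<omega>)"
      by (simp add: quot_modulus_def divide_ennreal_def mult_ac)
    also have "\<dots> = inverse (\<rho> (ennreal (s k))) * ?\<omega>N"
      using elim(2) fin by (simp add: less_top[symmetric])
    \<comment> \<open>Positivity of \<open>s k\<close> makes \<open>p k\<close> and
      \<open>q k\<close> distinct sites, as the maximum demands.\<close>
    also have "\<dots> \<le> seminorm_rho_N (XN k) \<rho> f"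
      unfolding s_def using elim(3) by (intro le_seminorm_rho_N P p q) (auto simp: s_def)
    finally show ?case using elim(1) by simp
  qed
qed

theorem theorem3p12:
  fixes X :: "'a::metric_space set"
    and f :: "'a \<Rightarrow> 'b::metric_space"
    and \<rho> :: "ennreal \<Rightarrow> ennreal"
    and r :: "nat \<Rightarrow> real"
    and XN :: "nat \<Rightarrow> 'a set"
  assumes "compact X"
    and "mono \<rho>"
    and "continuous_on UNIV (modulus X f)"
    and "\<forall>t. modulus X f t < \<infinity>"
    and "quot_modulus_continuous X \<rho> f"
    and "seminorm_rho X \<rho> f < \<infinity>"
    and "decseq r"
    and "r \<longlonglongrightarrow> 0"
    and "\<forall>k. finite (XN k)"
    and "\<forall>k. eps_net X (r k / 2) (XN k)"
    and "\<forall>k. XN k \<subseteq> XN (Suc k)"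
  shows "((\<lambda>k. seminorm_rho_N (XN k) \<rho> (restrict f (XN k))) \<longlonglongrightarrow> seminorm_rho X \<rho> f) \<and>
         ((\<lambda>k. seminorm_rho_N (XN k) \<rho> f) \<longlonglongrightarrow> seminorm_rho X \<rho> f)"
  \<comment> \<open>The discrete seminorm evaluates \<open>f\<close> only at the sites, so both
    limits are the same statement.\<close>
  unfolding seminorm_rho_N_restrict
  by (intro conjI tendsto_seminorm_rho_N[of X \<rho> f r XN]) (use assms in auto)

end
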